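(* Let $A \in \mathcal{M}_n^{+}$ be a positive semidefinite matrix with bandwidth $k$. Then $A$ has factor width at most $k$. Furthermore, if $k \in \{1,2\}$ then the factor width of $A$ equals $k$.
   Context: Let $\mathbb{F} \in \{\mathbb{R},\mathbb{C}\}$ (the result holds for either field). $\mathcal{M}_n^{+}$ denotes the set of $n \times n$ positive semidefinite (real symmetric if $\mathbb{F}=\mathbb{R}$, Hermitian if $\mathbb{F}=\mathbb{C}$) matrices over $\mathbb{F}$; $a_{i,j}$ is the $(i,j)$-entry of $A$. The bandwidth of a matrix $A$ is the smallest positive integer $k$ such that $a_{i,j}=0$ whenever $|i-j| \geq k$ (so diagonal matrices have bandwidth $1$). The factor width of $A \in \mathcal{M}_n^{+}$ is the smallest positive integer $k$ such that $A = \sum_{j=1}^r \mathbf{v}_j\mathbf{v}_j^*$ for some $r$ and some $\mathbf{v}_1,\ldots,\mathbf{v}_r \in \mathbb{F}^n$, each with at most $k$ non-zero entries. *)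

theory Defs
  imports "Jordan_Normal_Form.Schur_Decomposition"
begin

text \<open>The definitions are stated for the class common to \<^typ>\<open>real\<close> and \<^typ>\<open>complex\<close>, on which
  \<^const>\<open>conjugate\<close> is the identity and complex conjugation respectively. The order on
  \<^typ>\<open>complex\<close> is the partial one for which the nonnegative elements are exactly the nonnegative
  reals, so the inequality below includes that the quadratic form is real-valued.\<close>

definition psd_matrices :: "nat \<Rightarrow> 'a :: conjugatable_ordered_field mat set" where
  "psd_matrices n =
     {A \<in> carrier_mat n n. mat_adjoint A = A \<and> (\<forall>v \<in> carrier_vec n. 0 \<le> (A *\<^sub>v v) \<bullet>c v)}"

text \<open>Only differences of indices matter, so indexing from 0 is harmless.\<close>

definition bandwidth :: "'a :: zero mat \<Rightarrow> nat" where
  "bandwidth A = (LEAST k. 0 < k \<and>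
     (\<forall>i < dim_row A. \<forall>j < dim_col A. \<bar>int i - int j\<bar> \<ge> int k \<longrightarrow> A $$ (i, j) = 0))"

definition rank_one :: "'a :: conjugatable_ordered_field vec \<Rightarrow> 'a mat" where
  "rank_one v = (let V = mat_of_cols (dim_vec v) [v] in V * mat_adjoint V)"

definition num_nonzero :: "'a :: zero vec \<Rightarrow> nat" where
  "num_nonzero v = card {i. i < dim_vec v \<and> v $ i \<noteq> 0}"

text \<open>The list \<open>vs\<close> may be empty, so the zero matrix has factor width 1.
  The entries of the vectors are taken from the same field as those of \<open>A\<close>.\<close>

definition factor_width :: "'a :: conjugatable_ordered_field mat \<Rightarrow> nat" where
  "factor_width A = (LEAST k. 0 < k \<and>
     (\<exists>vs. (\<forall>v \<in> set vs. v \<in> carrier_vec (dim_row A) \<and> num_nonzero v \<le> k) \<and>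
        A = foldr (+) (map rank_one vs) (0\<^sub>m (dim_row A) (dim_row A))))"

end

theory Submission
  imports Defs
begin

text \<open>
  The bound is Cholesky factorisation. If the rows and columns of a positive semidefinite \<open>A\<close>
  before index \<open>m\<close> vanish and the pivot \<open>A $$ (m, m)\<close> is nonzero, then subtracting \<open>v v\<^sup>*\<close>, where
  \<open>v\<close> is column \<open>m\<close> divided by a square root of the pivot, also clears row and column \<open>m\<close> and leaves
  a positive semidefinite matrix (\<open>psd_eliminate_pivot\<close>). If the pivot is zero, semidefiniteness
  has already cleared them (\<open>psd_zero_pivot\<close>). When \<open>A\<close> has bandwidth \<open>k\<close>, the vector
  \<open>v\<close> lives on the \<open>k\<close> indices \<open>m, \<dots>, m + k - 1\<close>, so it has at most \<open>k\<close> nonzero entries, and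
  \<open>v v\<^sup>*\<close> lies inside the band: elimination creates no fill-in and can be repeated until nothing
  is left (\<open>banded_psd_decomposition\<close>).

  For the equalities, factor width is at least 1 by definition. If it is 1, then \<open>A\<close> is a sum of
  matrices \<open>v v\<^sup>*\<close> with \<open>v\<close> supported on one index, hence diagonal, so its bandwidth is 1; a
  matrix of bandwidth 2 therefore has factor width at least 2.

  The only property of the field beyond its class that enters is that every nonnegative element
  has the form \<open>s * conjugate s\<close>, which holds for the reals and for the complex numbers.
\<close>

section \<open>Bands and factorisations of bounded width\<close>

definition banded :: "nat \<Rightarrow> 'a :: zero mat \<Rightarrow> bool" where
  "banded k A \<longleftrightarrow>
     (\<forall>i < dim_row A. \<forall>j < dim_col A. \<bar>int i - int j\<bar> \<ge> int k \<longrightarrow> A $$ (i, j) = 0)"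

definition has_factors :: "nat \<Rightarrow> 'a :: conjugatable_ordered_field mat \<Rightarrow> bool" where
  "has_factors k A \<longleftrightarrow>
     (\<exists>vs. (\<forall>v \<in> set vs. v \<in> carrier_vec (dim_row A) \<and> num_nonzero v \<le> k) \<and>
        A = foldr (+) (map rank_one vs) (0\<^sub>m (dim_row A) (dim_row A)))"

lemma bandwidth_altdef: "bandwidth A = (LEAST k. 0 < k \<and> banded k A)"
  by (simp add: bandwidth_def banded_def)

lemma factor_width_altdef: "factor_width A = (LEAST k. 0 < k \<and> has_factors k A)"
  by (simp add: factor_width_def has_factors_def)

lemma bandwidth_spec: "0 < bandwidth A \<and> banded (bandwidth A) A"
  unfolding bandwidth_altdef
proof (rule LeastI)
  show "0 < Suc (dim_row A + dim_col A) \<and> banded (Suc (dim_row A + dim_col A)) A"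
    by (auto simp: banded_def)
qed

lemma bandwidth_le: "0 < k \<Longrightarrow> banded k A \<Longrightarrow> bandwidth A \<le> k"
  unfolding bandwidth_altdef by (rule Least_le) simp

lemma factor_width_le: "0 < k \<Longrightarrow> has_factors k A \<Longrightarrow> factor_width A \<le> k"
  unfolding factor_width_altdef by (rule Least_le) simp

lemma factor_width_spec:
  assumes "0 < k" "has_factors k A"
  shows "0 < factor_width A \<and> has_factors (factor_width A) A"
  unfolding factor_width_altdef by (rule LeastI[where k = k]) (use assms in simp)

section \<open>Entries of adjoints and of matrices of rank one\<close>

lemma index_mat_adjoint:
  "i < dim_col A \<Longrightarrow> j < dim_row A \<Longrightarrow> mat_adjoint A $$ (i, j) = conjugate (A $$ (j, i))"
  by (simp add: mat_adjoint_def mat_of_rows_def)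

lemma dim_mat_adjoint [simp]:
  "dim_row (mat_adjoint A) = dim_col A" "dim_col (mat_adjoint A) = dim_row A"
  by (simp_all add: mat_adjoint_def)

lemma mat_adjoint_eq_iff:
  assumes "A \<in> carrier_mat n n"
  shows "mat_adjoint A = A \<longleftrightarrow> (\<forall>i < n. \<forall>j < n. conjugate (A $$ (j, i)) = A $$ (i, j))"
  using assms by (auto simp: mat_eq_iff index_mat_adjoint)

lemma dim_rank_one [simp]: "dim_row (rank_one v) = dim_vec v" "dim_col (rank_one v) = dim_vec v"
  by (simp_all add: rank_one_def Let_def)

lemma rank_one_carrier [simp]: "v \<in> carrier_vec n \<Longrightarrow> rank_one v \<in> carrier_mat n n"
  by (auto simp: carrier_vecD)

lemma index_rank_one:
  assumes "i < dim_vec v" "j < dim_vec v"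
  shows "rank_one v $$ (i, j) = v $ i * conjugate (v $ j)"
  using assms
  by (simp add: rank_one_def Let_def mat_adjoint_def mat_of_rows_def mat_of_cols_def
      scalar_prod_def)

lemma rank_one_mult_vec:
  assumes v: "v \<in> carrier_vec n" and x: "x \<in> carrier_vec n"
  shows "rank_one v *\<^sub>v x = (x \<bullet>c v) \<cdot>\<^sub>v v"
proof (rule eq_vecI)
  fix i assume "i < dim_vec ((x \<bullet>c v) \<cdot>\<^sub>v v)"
  then have "i < n" using v by simp
  then show "(rank_one v *\<^sub>v x) $ i = ((x \<bullet>c v) \<cdot>\<^sub>v v) $ i"
    using v x
    by (simp add: scalar_prod_def index_rank_one sum_distrib_left mult_ac)
qed simp

lemma conjugate_cscalar_prod:
  fixes v w :: "'a :: conjugatable_field vec"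
  assumes "v \<in> carrier_vec n" "w \<in> carrier_vec n"
  shows "conjugate (v \<bullet>c w) = w \<bullet>c v"
  using assms by (simp add: scalar_prod_def sum_conjugate conjugate_dist_mul mult.commute)

lemma conjugate_one [simp]: "conjugate (1 :: 'a :: conjugatable_field) = 1"
  using conjugate_dist_mul[of 1 "conjugate 1 :: 'a"] by simp

lemma conjugate_unit_vec [simp]:
  "conjugate (unit_vec n i) = (unit_vec n i :: 'a :: conjugatable_field vec)"
  by (rule eq_vecI) (auto simp: unit_vec_def)

section \<open>Elimination in positive semidefinite matrices\<close>

lemma psd_matricesD:
  assumes "A \<in> psd_matrices n"
  shows "A \<in> carrier_mat n n"
    and "\<And>i j. i < n \<Longrightarrow> j < n \<Longrightarrow> conjugate (A $$ (j, i)) = A $$ (i, j)"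
    and "\<And>x. x \<in> carrier_vec n \<Longrightarrow> 0 \<le> (A *\<^sub>v x) \<bullet>c x"
  using assms mat_adjoint_eq_iff[of A n] by (auto simp: psd_matrices_def)

lemma hermitian_row_mult:
  assumes A: "A \<in> psd_matrices n" and m: "m < n" and x: "x \<in> carrier_vec n"
  shows "x \<bullet>c col A m = (A *\<^sub>v x) $ m"
  using psd_matricesD(1,2)[OF A] m x
  by (auto simp: scalar_prod_def mult.commute intro!: sum.cong)

text \<open>
  Semidefiniteness is exploited only by moving along a coordinate axis. As a polynomial in \<open>t\<close> the
  quadratic form below has the linear coefficient \<open>(A x)\<^sub>m\<close> and the pivot as quadratic coefficient.
\<close>

lemma quadratic_form_shift:
  assumes A: "A \<in> psd_matrices n" and m: "m < n" and x: "x \<in> carrier_vec n"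
  defines "w \<equiv> (A *\<^sub>v x) $ m" and "y \<equiv> \<lambda>t. x + t \<cdot>\<^sub>v unit_vec n m"
  shows "(A *\<^sub>v y t) \<bullet>c y t = (A *\<^sub>v x) \<bullet>c x + t * conjugate w + conjugate t * w
           + t * conjugate t * A $$ (m, m)"
proof -
  let ?e = "unit_vec n m :: 'a vec"
  note Ac = psd_matricesD(1)[OF A]
  have e: "?e \<in> carrier_vec n" by simp
  have Ae: "A *\<^sub>v ?e = col A m"
    using Ac m by (auto intro!: eq_vecI)
  have c: "col A m \<in> carrier_vec n" using Ac by auto
  have Ax: "A *\<^sub>v x \<in> carrier_vec n" using Ac x by simp
  have 1: "A *\<^sub>v y t = A *\<^sub>v x + t \<cdot>\<^sub>v col A m"
    unfolding y_def using mult_add_distrib_mat_vec[OF Ac x, of "t \<cdot>\<^sub>v ?e"] mult_mat_vec[OF Ac e]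
    by (simp add: Ae)
  have 2: "conjugate (y t) = conjugate x + conjugate t \<cdot>\<^sub>v ?e"
    unfolding y_def using conjugate_add_vec[OF x, of "t \<cdot>\<^sub>v ?e"]
    by (simp add: conjugate_smult_vec)
  have 3: "col A m \<bullet>c x = conjugate w"
    unfolding w_def using hermitian_row_mult[OF A m x] conjugate_cscalar_prod[OF x c] by simp
  have cx: "conjugate x \<in> carrier_vec n" using x by simp
  have "(A *\<^sub>v y t) \<bullet>c y t = ((A *\<^sub>v x) \<bullet>c x + conjugate t * ((A *\<^sub>v x) \<bullet> ?e))
      + t * (col A m \<bullet>c x + conjugate t * (col A m \<bullet> ?e))"
    unfolding 1 2
    using Ax c cx e
    by (simp add: add_scalar_prod_distrib[of _ n] scalar_prod_add_distrib[of _ n] algebra_simps)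
  also have "(A *\<^sub>v x) \<bullet> ?e = w" using Ax m by (simp add: w_def)
  also have "col A m \<bullet> ?e = A $$ (m, m)" using c m Ac by simp
  finally show ?thesis by (simp add: 3 algebra_simps)
qed

text \<open>
  With a zero pivot the form is affine in \<open>t\<close>, so it can stay nonnegative only if its linear
  coefficient vanishes; starting at a coordinate vector, that coefficient is an entry of row \<open>m\<close>.
\<close>

lemma psd_zero_pivot:
  fixes A :: "'a :: conjugatable_ordered_field mat"
  assumes A: "A \<in> psd_matrices n" and m: "m < n" and pivot: "A $$ (m, m) = 0" and i: "i < n"
  shows "A $$ (m, i) = 0"
proof (rule ccontr)
  assume nz: "A $$ (m, i) \<noteq> 0"
  let ?e = "unit_vec n i :: 'a vec"
  let ?a = "A $$ (i, i)" and ?w = "A $$ (m, i)"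
  note Ac = psd_matricesD(1)[OF A]
  have w: "(A *\<^sub>v ?e) $ m = ?w" using Ac m i by simp
  have q: "(A *\<^sub>v ?e) \<bullet> ?e = ?a"
    using Ac i by simp
  have a: "conjugate ?a = ?a" using psd_matricesD(2)[OF A i i] by simp
  have a0: "0 \<le> ?a" using psd_matricesD(3)[OF A, of ?e] q by simp
  (* This t makes each of the two linear terms equal to - (a + 1), whatever the phase of w. *)
  define t where "t = - (?a + 1) / conjugate ?w"
  have t: "t * conjugate ?w = - (?a + 1)" using nz by (simp add: t_def)
  have "conjugate t * ?w = conjugate (t * conjugate ?w)" by (simp add: conjugate_dist_mul)
  also have "\<dots> = - (?a + 1)" unfolding t by (simp only: conjugate_neg conjugate_dist_add a conjugate_one)
  finally have t': "conjugate t * ?w = - (?a + 1)" .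
  have "0 \<le> ?a + t * conjugate ?w + conjugate t * ?w"
    using psd_matricesD(3)[OF A, of "?e + t \<cdot>\<^sub>v unit_vec n m"]
      quadratic_form_shift[OF A m, of ?e t] pivot by (simp add: w q)
  then have le: "0 \<le> - 2 - ?a" unfolding t t' by simp
  have one: "0 \<le> (1 :: 'a)" using conjugate_square_positive[of "1 :: 'a"] by simp
  (* The order is only compatible with addition, so the contradiction is assembled as 1 <= 0. *)
  have "(1 :: 'a) \<le> 1 + (?a + 1 + (- 2 - ?a))"
    using add_mono[OF order_refl[of 1] add_mono[OF add_mono[OF a0 one] le]] by simp
  then have "(1 :: 'a) \<le> 0" by simp
  with one show False by simp
qed

text \<open>
  The quadratic form of the remainder at \<open>x\<close> is the minimum of the form of \<open>A\<close> over the line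
  through \<open>x\<close> parallel to axis \<open>m\<close>, and therefore nonnegative.
\<close>

lemma psd_eliminate_pivot:
  fixes A :: "'a :: conjugatable_ordered_field mat"
  assumes A: "A \<in> psd_matrices n" and m: "m < n"
    and pivot: "A $$ (m, m) = s * conjugate s" "s \<noteq> 0"
  defines "v \<equiv> (1 / conjugate s) \<cdot>\<^sub>v col A m"
  shows "A - rank_one v \<in> psd_matrices n"
    and "i < n \<Longrightarrow> (A - rank_one v) $$ (m, i) = 0"
proof -
  note Ac = psd_matricesD(1)[OF A]
  have c: "col A m \<in> carrier_vec n" using Ac by auto
  have v: "v \<in> carrier_vec n" using c by (simp add: v_def)
  note R = rank_one_carrier[OF v]
  have entry: "(A - rank_one v) $$ (i, j) = A $$ (i, j) - v $ i * conjugate (v $ j)"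
    if "i < n" "j < n" for i j
    using that v R by (simp add: index_rank_one)
  have conj_inv: "conjugate (1 / conjugate s) = 1 / s"
  proof -
    have "conjugate (1 / conjugate s) * s = conjugate (1 / conjugate s * conjugate s)"
      by (simp only: conjugate_dist_mul conjugate_id)
    also have "\<dots> = 1" using pivot(2) by simp
    finally show ?thesis using pivot(2) by (simp add: field_simps)
  qed
  have dv: "v $ i = A $$ (i, m) / conjugate s" if "i < n" for i
    using that m Ac by (simp add: v_def)
  have vm: "v $ m = s" using dv[OF m] pivot by simp
  show "(A - rank_one v) $$ (m, i) = 0" if "i < n"
  proof -
    have "v $ i = 1 / conjugate s * A $$ (i, m)" using dv[OF that] by simp
    then have "conjugate (v $ i) = A $$ (m, i) / s"
      using psd_matricesD(2)[OF A m that] by (simp only: conjugate_dist_mul conj_inv) simp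
    then show ?thesis using pivot(2) by (simp add: entry[OF m that] vm)
  qed
  have herm: "mat_adjoint (A - rank_one v) = A - rank_one v"
  proof -
    have "conjugate ((A - rank_one v) $$ (j, i)) = (A - rank_one v) $$ (i, j)"
      if "i < n" "j < n" for i j
    proof -
      have "conjugate (A $$ (j, i) - v $ j * conjugate (v $ i))
          = conjugate (A $$ (j, i)) - conjugate (v $ j) * v $ i"
        unfolding diff_conv_add_uminus
        by (simp only: conjugate_dist_add conjugate_neg conjugate_dist_mul conjugate_id)
      then show ?thesis
        using that psd_matricesD(2)[OF A that] by (simp add: entry mult.commute)
    qed
    moreover have "A - rank_one v \<in> carrier_mat n n" by (rule minus_carrier_mat[OF R])
    ultimately show ?thesis by (simp add: mat_adjoint_eq_iff)
  qed
  have form: "0 \<le> ((A - rank_one v) *\<^sub>v x) \<bullet>c x" if x: "x \<in> carrier_vec n" for x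
  proof -
    define w where "w = (A *\<^sub>v x) $ m"
    have cx: "conjugate x \<in> carrier_vec n" using x by simp
    have xv: "x \<bullet>c v = w / s"
    proof -
      have "x \<bullet>c v = (1 / s) * (x \<bullet>c col A m)"
        unfolding v_def conjugate_smult_vec conj_inv
        using x c by (subst scalar_prod_smult_distrib[of _ n]) auto
      then show ?thesis using hermitian_row_mult[OF A m x] by (simp add: w_def)
    qed
    have vx: "v \<bullet>c x = conjugate w / conjugate s"
    proof -
      have "v \<bullet>c x = (1 / conjugate s) * (col A m \<bullet>c x)"
        unfolding v_def using cx c by (subst smult_scalar_prod_distrib[of _ n]) auto
      then show ?thesis
        using hermitian_row_mult[OF A m x] conjugate_cscalar_prod[OF x c] by (simp add: w_def)
    qed
    have "((A - rank_one v) *\<^sub>v x) \<bullet>c x = (A *\<^sub>v x) \<bullet>c x - (rank_one v *\<^sub>v x) \<bullet>c x"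
      using Ac R x cx
      by (simp add: minus_mult_distrib_mat_vec[of _ n n] minus_scalar_prod_distrib[of _ n])
    also have "(rank_one v *\<^sub>v x) \<bullet>c x = (x \<bullet>c v) * (v \<bullet>c x)"
      unfolding rank_one_mult_vec[OF v x] using v cx by (simp add: smult_scalar_prod_distrib[of _ n])
    also have "\<dots> = w * conjugate w / A $$ (m, m)"
      unfolding xv vx pivot(1) by simp
    finally have lhs: "((A - rank_one v) *\<^sub>v x) \<bullet>c x
        = (A *\<^sub>v x) \<bullet>c x - w * conjugate w / A $$ (m, m)" .
    (* the minimiser along the axis *)
    define t where "t = - w / A $$ (m, m)"
    have p0: "A $$ (m, m) \<noteq> 0" using pivot by simp
    have "conjugate t * A $$ (m, m) = conjugate (t * A $$ (m, m))"
      using psd_matricesD(2)[OF A m m] by (simp add: conjugate_dist_mul)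
    also have "\<dots> = - conjugate w" using p0 by (simp add: t_def conjugate_neg)
    finally have t': "conjugate t = - conjugate w / A $$ (m, m)"
      using p0 by (simp add: field_simps)
    have "0 \<le> (A *\<^sub>v x) \<bullet>c x + t * conjugate w + conjugate t * w + t * conjugate t * A $$ (m, m)"
      using psd_matricesD(3)[OF A, of "x + t \<cdot>\<^sub>v unit_vec n m"] x
        quadratic_form_shift[OF A m x, of t] by (simp add: w_def)
    also have "\<dots> = (A *\<^sub>v x) \<bullet>c x - w * conjugate w / A $$ (m, m)"
      unfolding t' using p0 by (simp add: t_def field_simps)
    finally show ?thesis by (simp add: lhs)
  qed
  show "A - rank_one v \<in> psd_matrices n"
    using herm form minus_carrier_mat[OF R] by (simp add: psd_matrices_def)
qed

section \<open>Cholesky factorisation within the band\<close>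

lemma num_nonzero_le_interval:
  assumes "\<And>i. i < dim_vec v \<Longrightarrow> v $ i \<noteq> 0 \<Longrightarrow> m \<le> i \<and> i < m + k"
  shows "num_nonzero v \<le> k"
proof -
  have "{i. i < dim_vec v \<and> v $ i \<noteq> 0} \<subseteq> {m..<m + k}" using assms by auto
  then have "num_nonzero v \<le> card {m..<m + k}"
    unfolding num_nonzero_def by (intro card_mono) auto
  then show ?thesis by simp
qed

text \<open>
  The dimension stays fixed and the induction runs over the number of rows not yet cleared, so that
  the vectors found at different stages need no padding.
\<close>

lemma banded_psd_decomposition:
  fixes A :: "'a :: conjugatable_ordered_field mat"
  assumes sqrt: "\<forall>a :: 'a. 0 \<le> a \<longrightarrow> (\<exists>s. a = s * conjugate s)"
    and "A \<in> psd_matrices n" "banded k A" "m \<le> n"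
    and "\<And>i j. i < m \<Longrightarrow> j < n \<Longrightarrow> A $$ (i, j) = 0"
  shows "has_factors k A"
  using \<open>m \<le> n\<close> assms(2,3,5)
proof (induction m arbitrary: A rule: inc_induct)
  case (base A)
  have "A = 0\<^sub>m n n" using psd_matricesD(1)[OF base(1)] base(3) by (intro eq_matI) auto
  then show ?case unfolding has_factors_def by (intro exI[of _ "[]"]) auto
next
  case (step m A)
  note A = step.prems(1) and band = step.prems(2) and cleared = step.prems(3)
  note Ac = psd_matricesD(1)[OF A] and m = \<open>m < n\<close>
  show ?case
  proof (cases "A $$ (m, m) = 0")
    case True
    show ?thesis
      using step.IH[OF A band] cleared psd_zero_pivot[OF A m True] by (metis less_Suc_eq)
  next
    case False
    let ?e = "unit_vec n m :: 'a vec"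
    have "0 \<le> A $$ (m, m)"
      using psd_matricesD(3)[OF A, of ?e] Ac m by simp
    then obtain s where s: "A $$ (m, m) = s * conjugate s" using sqrt by blast
    with False have s0: "s \<noteq> 0" by auto
    define v where "v = (1 / conjugate s) \<cdot>\<^sub>v col A m"
    have v: "v \<in> carrier_vec n" using Ac by (auto simp: v_def)
    note R = rank_one_carrier[OF v]
    have B: "A - rank_one v \<in> psd_matrices n"
      and row_m: "\<And>i. i < n \<Longrightarrow> (A - rank_one v) $$ (m, i) = 0"
      using psd_eliminate_pivot[OF A m s s0] by (simp_all add: v_def)
    have supp: "m \<le> i \<and> i < m + k" if i: "i < n" and nz: "v $ i \<noteq> 0" for i
    proof -
      have nzA: "A $$ (i, m) \<noteq> 0" using nz i m Ac by (auto simp: v_def)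
      have "m \<le> i" using cleared[of i m] nzA m by force
      moreover have "\<not> int k \<le> \<bar>int i - int m\<bar>" using nzA band i m Ac by (auto simp: banded_def)
      ultimately show ?thesis by auto
    qed
    have B_entry: "(A - rank_one v) $$ (i, j) = A $$ (i, j) - v $ i * conjugate (v $ j)"
      if "i < n" "j < n" for i j
      using that v R by (simp add: index_rank_one)
    have "banded k (A - rank_one v)"
    proof -
      have "(A - rank_one v) $$ (i, j) = 0"
        if ij: "i < n" "j < n" and far: "int k \<le> \<bar>int i - int j\<bar>" for i j
      proof -
        have "A $$ (i, j) = 0" using band ij far Ac by (auto simp: banded_def)
        moreover have "v $ i = 0 \<or> v $ j = 0"
          using supp[OF ij(1)] supp[OF ij(2)] far by linarith
        ultimately show ?thesis using ij by (auto simp: B_entry)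
      qed
      then show ?thesis using R by (auto simp: banded_def)
    qed
    moreover have "(A - rank_one v) $$ (i, j) = 0" if "i < Suc m" "j < n" for i j
    proof (cases "i = m")
      case False
      then have "i < m" using that by simp
      moreover from this have "v $ i = 0" using supp[of i] m by force
      ultimately show ?thesis using that cleared m by (simp add: B_entry)
    qed (use row_m that in simp)
    ultimately have "has_factors k (A - rank_one v)" using step.IH[OF B] by blast
    then obtain vs where vs: "\<forall>v \<in> set vs. v \<in> carrier_vec n \<and> num_nonzero v \<le> k"
      and sum: "A - rank_one v = foldr (+) (map rank_one vs) (0\<^sub>m n n)"
      using R unfolding has_factors_def by auto
    have "num_nonzero v \<le> k" using supp v by (intro num_nonzero_le_interval[where m = m]) auto
    moreover have "A = rank_one v + (A - rank_one v)"
      using Ac R by (intro eq_matI) auto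
    ultimately show ?thesis
      unfolding has_factors_def
      using vs v Ac sum by (intro exI[of _ "v # vs"]) auto
  qed
qed

section \<open>Comparison of factor width and bandwidth\<close>

lemma sum_rank_one_carrier:
  "\<forall>v \<in> set vs. v \<in> carrier_vec n \<Longrightarrow>
    foldr (+) (map rank_one vs) (0\<^sub>m n n) \<in> carrier_mat n n"
  by (induction vs) auto

lemma has_factors_1_imp_diagonal:
  assumes "has_factors 1 A"
  shows "banded 1 A"
proof -
  define n where "n = dim_row A"
  from assms obtain vs where vs: "\<forall>v \<in> set vs. v \<in> carrier_vec n \<and> num_nonzero v \<le> 1"
    and A: "A = foldr (+) (map rank_one vs) (0\<^sub>m n n)"
    unfolding has_factors_def n_def by blast
  have off: "v $ i = 0 \<or> v $ j = 0"
    if "v \<in> carrier_vec n" "num_nonzero v \<le> 1" "i < n" "j < n" "i \<noteq> j" for v :: "'a vec" and i j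
  proof (rule ccontr)
    assume "\<not> (v $ i = 0 \<or> v $ j = 0)"
    then have "card {i, j} \<le> num_nonzero v"
      unfolding num_nonzero_def using that by (intro card_mono) auto
    with that show False by simp
  qed
  have "foldr (+) (map rank_one vs) (0\<^sub>m n n) $$ (i, j) = 0" if ij: "i < n" "j < n" "i \<noteq> j" for i j
    using vs
  proof (induction vs)
    case (Cons v vs)
    have "foldr (+) (map rank_one vs) (0\<^sub>m n n) \<in> carrier_mat n n"
      using Cons.prems by (intro sum_rank_one_carrier) auto
    moreover have "rank_one v $$ (i, j) = 0"
      using Cons.prems off[of v i j] ij by (auto simp: index_rank_one)
    ultimately show ?case using Cons ij by simp
  qed (use ij in simp)
  moreover have "A \<in> carrier_mat n n" unfolding A using vs by (intro sum_rank_one_carrier) auto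
  ultimately show ?thesis by (auto simp: banded_def A)
qed

lemma factor_width_bandwidth:
  fixes A :: "'a :: conjugatable_ordered_field mat"
  assumes sqrt: "\<forall>a :: 'a. 0 \<le> a \<longrightarrow> (\<exists>s. a = s * conjugate s)"
    and A: "A \<in> psd_matrices n"
  shows "factor_width A \<le> bandwidth A"
    and "bandwidth A \<in> {1, 2} \<Longrightarrow> factor_width A = bandwidth A"
proof -
  have bw: "0 < bandwidth A" "banded (bandwidth A) A" using bandwidth_spec by auto
  have factors: "has_factors (bandwidth A) A"
    using banded_psd_decomposition[OF sqrt A bw(2), of 0] by auto
  show le: "factor_width A \<le> bandwidth A" by (rule factor_width_le[OF bw(1) factors])
  have fw: "0 < factor_width A" "has_factors (factor_width A) A"
    using factor_width_spec[OF bw(1) factors] by auto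
  show "factor_width A = bandwidth A" if "bandwidth A \<in> {1, 2}"
  proof (cases "factor_width A = 1")
    case True
    then have "banded 1 A" using fw(2) has_factors_1_imp_diagonal by metis
    then have "bandwidth A \<le> 1" by (intro bandwidth_le) auto
    with True le show ?thesis by simp
  next
    case False
    with that le fw(1) show ?thesis by auto
  qed
qed

lemma real_square_root: "\<forall>a :: real. 0 \<le> a \<longrightarrow> (\<exists>s. a = s * conjugate s)"
proof (intro allI impI)
  fix a :: real assume "0 \<le> a"
  then show "\<exists>s. a = s * conjugate s" by (intro exI[of _ "sqrt a"]) simp
qed

lemma complex_square_root: "\<forall>a :: complex. 0 \<le> a \<longrightarrow> (\<exists>s. a = s * conjugate s)"
proof (intro allI impI)
  fix a :: complex assume "0 \<le> a"
  then show "\<exists>s. a = s * conjugate s"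
    by (intro exI[of _ "complex_of_real (sqrt (Re a))"])
      (auto simp: complex_eq_iff less_eq_complex_def)
qed

theorem theorem1:
  shows "(\<forall>n k. \<forall>A :: real mat. A \<in> psd_matrices n \<longrightarrow> bandwidth A = k \<longrightarrow>
            factor_width A \<le> k \<and> (k \<in> {1, 2} \<longrightarrow> factor_width A = k)) \<and>
         (\<forall>n k. \<forall>A :: complex mat. A \<in> psd_matrices n \<longrightarrow> bandwidth A = k \<longrightarrow>
            factor_width A \<le> k \<and> (k \<in> {1, 2} \<longrightarrow> factor_width A = k))"
  by (auto simp del: insert_iff
      simp: factor_width_bandwidth[OF real_square_root] factor_width_bandwidth[OF complex_square_root])

end
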